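(* Let $t\geq 6$. There exists $r_t$ such that $K_t$ is $r$-rainbow-uncommon for all $r\geq r_t$.
   Context: All graphs are simple. A copy of a graph $H$ in a graph $G$ is a subgraph of $G$ isomorphic to $H$. An $r$-coloring of a set $X$ is a surjective function $c:X\to\{1,\dots,r\}$. Under an edge-coloring of $G$, a subgraph $H$ is rainbow if all edges of $H$ receive pairwise distinct colors. For a graph $H$ with $e$ edges, let $M_{\mathrm{rb}}(H;n,r)$ be the maximum, over all $r$-colorings of $E(K_n)$, of the number of rainbow copies of $H$ in $K_n$; let $m_{\mathrm{rb}}(H;n,r)=M_{\mathrm{rb}}(H;n,r)/(\text{number of copies of } H \text{ in } K_n)$ and $m_{\mathrm{rb}}(H;r)=\lim_{n\to\infty} m_{\mathrm{rb}}(H;n,r)$ (this limit exists). $H$ is called $r$-rainbow-common if $m_{\mathrm{rb}}(H;r)=\binom{r}{e}e!/r^e$, and $r$-rainbow-uncommon otherwise. *)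

theory Defs
  imports Complex_Main "HOL-Library.Ramsey"
begin

type_synonym 'a sgraph = "'a set \<times> 'a set set"

abbreviation verts_of :: "'a sgraph \<Rightarrow> 'a set" where
  "verts_of G \<equiv> fst G"

abbreviation edges_of :: "'a sgraph \<Rightarrow> 'a set set" where
  "edges_of G \<equiv> snd G"

definition simple_graph :: "'a sgraph \<Rightarrow> bool" where
  "simple_graph G \<longleftrightarrow> finite (verts_of G) \<and> edges_of G \<subseteq> [verts_of G]\<^bsup>2\<^esup>"

definition subgraph_of :: "'a sgraph \<Rightarrow> 'a sgraph \<Rightarrow> bool" where
  "subgraph_of S G \<longleftrightarrow>
     simple_graph S \<and> verts_of S \<subseteq> verts_of G \<and> edges_of S \<subseteq> edges_of G"

definition graph_isomorphic :: "'a sgraph \<Rightarrow> 'b sgraph \<Rightarrow> bool" where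
  "graph_isomorphic G H \<longleftrightarrow>
     (\<exists>f. bij_betw f (verts_of G) (verts_of H) \<and>
          (\<forall>u\<in>verts_of G. \<forall>v\<in>verts_of G. {u, v} \<in> edges_of G \<longleftrightarrow> {f u, f v} \<in> edges_of H))"

definition complete_graph :: "nat \<Rightarrow> nat sgraph" where
  "complete_graph n = ({..<n}, [{..<n}]\<^bsup>2\<^esup>)"

lemma simple_graph_complete_graph: "simple_graph (complete_graph n)"
  by (simp add: simple_graph_def complete_graph_def)

definition copies :: "'b sgraph \<Rightarrow> 'a sgraph \<Rightarrow> 'a sgraph set" where
  "copies H G = {S. subgraph_of S G \<and> graph_isomorphic S H}"

definition is_coloring :: "nat \<Rightarrow> 'a set \<Rightarrow> ('a \<Rightarrow> nat) \<Rightarrow> bool" where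
  "is_coloring r X c \<longleftrightarrow> c ` X = {1..r}"

definition rainbow :: "('a set \<Rightarrow> nat) \<Rightarrow> 'a sgraph \<Rightarrow> bool" where
  "rainbow c S \<longleftrightarrow> inj_on c (edges_of S)"

(* If n choose 2 < r there is no r-coloring and the value is Max {}, which is unspecified;
   this concerns only finitely many n for fixed r. *)
definition max_rainbow_copies :: "'a sgraph \<Rightarrow> nat \<Rightarrow> nat \<Rightarrow> nat" where
  "max_rainbow_copies H n r =
     Max {card {S \<in> copies H (complete_graph n). rainbow c S} | c.
            is_coloring r (edges_of (complete_graph n)) c}"

definition max_rainbow_ratio :: "'a sgraph \<Rightarrow> nat \<Rightarrow> nat \<Rightarrow> real" where
  "max_rainbow_ratio H n r =
     real (max_rainbow_copies H n r) / real (card (copies H (complete_graph n)))"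

definition max_rainbow_density :: "'a sgraph \<Rightarrow> nat \<Rightarrow> real" where
  "max_rainbow_density H r = lim (\<lambda>n. max_rainbow_ratio H n r)"

definition rainbow_common :: "nat \<Rightarrow> 'a sgraph \<Rightarrow> bool" where
  "rainbow_common r H \<longleftrightarrow>
     max_rainbow_density H r =
       real (r choose card (edges_of H)) * fact (card (edges_of H)) / real r ^ card (edges_of H)"

definition rainbow_uncommon :: "nat \<Rightarrow> 'a sgraph \<Rightarrow> bool" where
  "rainbow_uncommon r H \<longleftrightarrow> \<not> rainbow_common r H"

end

(* Give every vertex an independent fair sign x_v and color the edge uv with color k with probability
   (1 + b_k x_u x_v) / r, where b_1 = 1, b_2 = b_3 = -1/2 and all other biases vanish. Fix an
   injective coloring of the edges of a t-clique and expand the product of the factors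
   1 + b x_u x_v over edge sets S. The expectation over the signs vanishes unless S is an even
   graph, and the product of the biases vanishes unless S uses only the colors 1, 2, 3, so only
   the empty set and triangles colored 1, 2, 3 survive; the latter contribute b_1 b_2 b_3 = 1/4.
   Hence every t-clique is rainbow with probability exceeding that in the uniform random
   coloring by an amount independent of n. *)

theory Submission
  imports Defs
begin

section \<open>Signs\<close>

text \<open>A product over the set itself needs no ordering of the two ends: for an edge
  \<open>{u, v}\<close> it is \<open>x u * x v\<close>.\<close>

definition edge_sign :: "('a \<Rightarrow> real) \<Rightarrow> 'a set \<Rightarrow> real" where
  "edge_sign x e = (\<Prod>v\<in>e. x v)"

abbreviation sign_vectors :: "'a set \<Rightarrow> ('a \<Rightarrow> real) set" where
  "sign_vectors V \<equiv> V \<rightarrow>\<^sub>E {-1, 1}"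

text \<open>An edge \<open>e\<close> will get color \<open>k\<close> with probability \<open>(1 + color_bias k * edge_sign x e) / r\<close>.
  The biases sum to \<open>0\<close> and their product over the colors 1, 2, 3 is positive.\<close>

definition color_bias :: "nat \<Rightarrow> real" where
  "color_bias k = (if k = 1 then 1 else if k = 2 \<or> k = 3 then - 1/2 else 0)"

lemma card_sign_vectors: "finite V \<Longrightarrow> card (sign_vectors V) = 2 ^ card V"
  by (simp add: card_funcsetE numeral_2_eq_2)

text \<open>In the product over \<open>S\<close> each \<open>x v\<close> is raised to the degree of
  \<open>v\<close> in \<open>S\<close>. The signs are independent, so the sum factors over the
  vertices, and an odd degree makes its factor \<open>(-1) + 1 = 0\<close>. Only even edge sets
  survive.\<close>

lemma sum_prod_edge_sign:
  assumes V: "finite V" and S: "S \<subseteq> Pow V"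
  shows "(\<Sum>x\<in>sign_vectors V. \<Prod>e\<in>S. edge_sign x e) =
         (\<Prod>v\<in>V. if even (card {e\<in>S. v \<in> e}) then 2 else 0)"
proof -
  have finS: "finite S" using S V by (meson finite_Pow_iff finite_subset)
  have "(\<Prod>e\<in>S. edge_sign x e) = (\<Prod>v\<in>V. x v ^ card {e\<in>S. v \<in> e})" for x :: "'a \<Rightarrow> real"
  proof -
    have "(\<Prod>e\<in>S. edge_sign x e) = (\<Prod>e\<in>S. \<Prod>v\<in>{v\<in>V. v \<in> e}. x v)"
      unfolding edge_sign_def using S by (intro prod.cong) auto
    also have "\<dots> = (\<Prod>v\<in>V. \<Prod>e\<in>{e\<in>S. v \<in> e}. x v)"
      by (rule prod.swap_restrict[OF finS V])
    finally show ?thesis by simp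
  qed
  then have "(\<Sum>x\<in>sign_vectors V. \<Prod>e\<in>S. edge_sign x e) =
        (\<Sum>x\<in>sign_vectors V. \<Prod>v\<in>V. x v ^ card {e\<in>S. v \<in> e})" by simp
  also have "\<dots> = (\<Prod>v\<in>V. \<Sum>y\<in>{-1, 1::real}. y ^ card {e\<in>S. v \<in> e})"
    by (rule prod_sum_PiE[symmetric]) (use V in auto)
  also have "\<dots> = (\<Prod>v\<in>V. if even (card {e\<in>S. v \<in> e}) then 2 else 0)"
    by (intro prod.cong) auto
  finally show ?thesis .
qed

text \<open>No term of the expansion can hurt. Nonzero biases force \<open>S\<close> to use only
  three colors, hence by injectivity at most three edges. One or two edges leave a vertex of degree
  one, and three edges carry all three biases, whose product is positive.\<close>

lemma bias_times_sign_nonneg: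
  assumes V: "finite V" and S: "S \<subseteq> [V]\<^bsup>2\<^esup>" and inj: "inj_on c S"
  shows "0 \<le> (\<Prod>e\<in>S. color_bias (c e)) * (\<Sum>x\<in>sign_vectors V. \<Prod>e\<in>S. edge_sign x e)"
proof -
  have SP: "S \<subseteq> Pow V" using S by (auto simp: nsets_def)
  have finS: "finite S" using SP V by (meson finite_Pow_iff finite_subset)
  have sign0: "(\<Sum>x\<in>sign_vectors V. \<Prod>e\<in>S. edge_sign x e) = 0"
    if "v \<in> V" "card {e\<in>S. v \<in> e} = 1" for v
    unfolding sum_prod_edge_sign[OF V SP] using that V by (auto simp: prod_zero_iff intro!: bexI[of _ v])
  have sign_ge: "(\<Sum>x\<in>sign_vectors V. \<Prod>e\<in>S. edge_sign x e) \<ge> 0"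
    unfolding sum_prod_edge_sign[OF V SP] by (intro prod_nonneg) auto
  consider "\<exists>e\<in>S. c e \<notin> {1, 2, 3}" | "c ` S \<subseteq> {1, 2, 3}" by blast
  then show ?thesis
  proof cases
    case 1
    then have "(\<Prod>e\<in>S. color_bias (c e)) = 0"
      using finS by (auto simp: color_bias_def intro!: prod_zero)
    then show ?thesis by simp
  next
    case 2
    have "card S = card (c ` S)" by (simp add: card_image inj)
    also have "\<dots> \<le> card {1, 2, 3::nat}" using 2 by (intro card_mono) auto
    finally have "card S \<le> 3" by simp
    then consider "card S = 0" | "card S = 1" | "card S = 2" | "card S = 3" by linarith
    then show ?thesis
    proof cases
      case 1
      then show ?thesis using finS by (simp add: sum_nonneg)
    next
      case 2
      then obtain e where e: "S = {e}" by (auto simp: card_1_singleton_iff)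
      then obtain u v where "e = {u, v}" "u \<in> V"
        using S by (auto simp: nsets_def card_2_iff)
      then have "u \<in> V" "{e'\<in>S. u \<in> e'} = {e}" using e by auto
      then show ?thesis using sign0[of u] by simp
    next
      case 3
      then obtain e f where ef: "S = {e, f}" "e \<noteq> f" by (auto simp: card_2_iff)
      \<comment> \<open>Distinct edges of equal size cannot contain each other, so some vertex lies
        on \<open>e\<close> alone and has degree one.\<close>
      then have "card e = 2" "card f = 2" "finite e" "finite f" using S by (auto simp: nsets_def)
      then have "\<not> e \<subseteq> f" using ef by (metis card_subset_eq)
      then obtain v where "v \<in> e" "v \<notin> f" by blast
      then have "v \<in> V" "{e'\<in>S. v \<in> e'} = {e}" using ef SP by auto
      then show ?thesis using sign0[of v] by simp
    next
      case 4
      \<comment> \<open>The shape of \<open>S\<close> is irrelevant for the sign: the bias product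
        is 1/4 in any case, and the sum over signs is nonnegative.\<close>
      then have "c ` S = {1, 2, 3}"
        using 2 by (intro card_subset_eq) (auto simp: card_image inj)
      then have "(\<Prod>e\<in>S. color_bias (c e)) = (\<Prod>k\<in>{1, 2, 3}. color_bias k)"
        using prod.reindex[OF inj, of color_bias] by simp
      also have "\<dots> = 1/4" by (simp add: color_bias_def)
      finally show ?thesis using sign_ge by simp
    qed
  qed
qed

text \<open>Multiplying out gives one term per edge subset; the biases do not depend on
  \<open>x\<close>, so the sum over signs moves inside.\<close>

lemma sum_prod_bias_expand:
  assumes V: "finite V" and E: "finite E"
  shows "(\<Sum>x\<in>sign_vectors V. \<Prod>e\<in>E. 1 + color_bias (c e) * edge_sign x e) =
         (\<Sum>S\<in>Pow E. (\<Prod>e\<in>S. color_bias (c e)) * (\<Sum>x\<in>sign_vectors V. \<Prod>e\<in>S. edge_sign x e))"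
proof -
  have "(\<Prod>e\<in>E. 1 + color_bias (c e) * edge_sign x e) =
        (\<Sum>S\<in>Pow E. (\<Prod>e\<in>S. color_bias (c e)) * (\<Prod>e\<in>S. edge_sign x e))" for x :: "'a \<Rightarrow> real"
    using prod_add[OF E, of "\<lambda>e. color_bias (c e) * edge_sign x e" "\<lambda>_. 1"]
    by (simp add: add.commute prod.distrib)
  then show ?thesis
    by (simp add: sum_distrib_left) (rule sum.swap)
qed

text \<open>The empty edge set alone contributes \<open>2 ^ card V\<close>, the value without any
  bias, and all other terms are nonnegative.\<close>

lemma sum_prod_bias_ge:
  assumes V: "finite V" and E: "E \<subseteq> [V]\<^bsup>2\<^esup>" and inj: "inj_on c E"
  shows "(\<Sum>x\<in>sign_vectors V. \<Prod>e\<in>E. 1 + color_bias (c e) * edge_sign x e) \<ge> 2 ^ card V"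
proof -
  have fin: "finite E" using E V by (meson finite_imp_finite_nsets finite_subset)
  define contrib where "contrib S = (\<Prod>e\<in>S. color_bias (c e)) * (\<Sum>x\<in>sign_vectors V. \<Prod>e\<in>S. edge_sign x e)" for S
  have "sum contrib {{}} \<le> sum contrib (Pow E)"
  proof (rule sum_mono2)
    show "0 \<le> contrib S" if "S \<in> Pow E - {{}}" for S
      unfolding contrib_def using that E inj by (intro bias_times_sign_nonneg V) (auto intro: inj_on_subset)
  qed (use fin in auto)
  moreover have "contrib {} = 2 ^ card V"
    using V by (simp add: contrib_def card_sign_vectors)
  ultimately show ?thesis
    unfolding sum_prod_bias_expand[OF V fin] contrib_def by simp
qed

text \<open>Besides the empty set, the triangle \<open>T\<close> is kept. It is an even graph, so
  its sign sum is the full \<open>2 ^ card V\<close>, weighted by the bias product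
  \<open>1 * (-1/2) * (-1/2) = 1/4\<close>.\<close>

lemma sum_prod_bias_ge_triangle:
  assumes V: "finite V" and E: "E \<subseteq> [V]\<^bsup>2\<^esup>" and inj: "inj_on c E"
    and tri: "a \<noteq> b" "b \<noteq> d" "a \<noteq> d" "{a, b} \<in> E" "{b, d} \<in> E" "{a, d} \<in> E"
    and c: "c {a, b} = 1" "c {b, d} = 2" "c {a, d} = 3"
  shows "(\<Sum>x\<in>sign_vectors V. \<Prod>e\<in>E. 1 + color_bias (c e) * edge_sign x e) \<ge> 5/4 * 2 ^ card V"
proof -
  have fin: "finite E" using E V by (meson finite_imp_finite_nsets finite_subset)
  define contrib where "contrib S = (\<Prod>e\<in>S. color_bias (c e)) * (\<Sum>x\<in>sign_vectors V. \<Prod>e\<in>S. edge_sign x e)" for S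
  define T where "T = {{a, b}, {b, d}, {a, d}}"
  have dist: "{a, b} \<noteq> {b, d}" "{a, b} \<noteq> {a, d}" "{b, d} \<noteq> {a, d}"
    using tri by (auto simp: doubleton_eq_iff)
  have "sum contrib {{}, T} \<le> sum contrib (Pow E)"
  proof (rule sum_mono2)
    show "0 \<le> contrib S" if "S \<in> Pow E - {{}, T}" for S
      unfolding contrib_def using that E inj by (intro bias_times_sign_nonneg V) (auto intro: inj_on_subset)
  qed (use fin tri in \<open>auto simp: T_def\<close>)
  moreover have "contrib {} = 2 ^ card V"
    using V by (simp add: contrib_def card_sign_vectors)
  moreover have "contrib T = 1/4 * 2 ^ card V"
  proof -
    have abd: "a \<in> V" "b \<in> V" "d \<in> V" using tri E by (auto simp: nsets_def)
    \<comment> \<open>Each corner lies on exactly two of the three edges, every other vertex on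
      none.\<close>
    have even: "even (card {e\<in>T. v \<in> e})" for v
    proof -
      consider "v = a" | "v = b" | "v = d" | "v \<notin> {a, b, d}" by blast
      then show ?thesis
      proof cases
        case 1
        then have "{e\<in>T. v \<in> e} = {{a, b}, {a, d}}" using tri by (auto simp: T_def)
        then show ?thesis using dist by simp
      next
        case 2
        then have "{e\<in>T. v \<in> e} = {{a, b}, {b, d}}" using tri by (auto simp: T_def)
        then show ?thesis using dist by simp
      next
        case 3
        then have "{e\<in>T. v \<in> e} = {{b, d}, {a, d}}" using tri by (auto simp: T_def)
        then show ?thesis using dist by simp
      next
        case 4
        then have "{e\<in>T. v \<in> e} = {}" by (auto simp: T_def)
        then show ?thesis by (simp only: card.empty even_zero)
      qed
    qed
    have "(\<Sum>x\<in>sign_vectors V. \<Prod>e\<in>T. edge_sign x e) = 2 ^ card V"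
      by (subst sum_prod_edge_sign) (use V abd even in \<open>auto simp: T_def\<close>)
    moreover have "(\<Prod>e\<in>T. color_bias (c e)) = 1/4"
      using dist by (simp add: T_def c color_bias_def)
    ultimately show ?thesis by (simp add: contrib_def)
  qed
  moreover have "T \<noteq> {}" by (simp add: T_def)
  ultimately show ?thesis
    unfolding sum_prod_bias_expand[OF V fin] contrib_def by simp
qed

section \<open>The biased random coloring\<close>

text \<open>Marginalization of a product measure: \<open>f\<close> sees only the coordinates in
  \<open>B\<close>, and every other coordinate sums out to 1.\<close>

lemma sum_PiE_marginal:
  fixes w :: "'a \<Rightarrow> 'b \<Rightarrow> real"
  assumes A: "finite A" and C: "finite C" and B: "B \<subseteq> A"
    and w: "\<And>e. e \<in> A \<Longrightarrow> (\<Sum>k\<in>C. w e k) = 1"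
  shows "(\<Sum>c\<in>A \<rightarrow>\<^sub>E C. (\<Prod>e\<in>A. w e (c e)) * f (restrict c B)) =
         (\<Sum>g\<in>B \<rightarrow>\<^sub>E C. (\<Prod>e\<in>B. w e (g e)) * f g)"
proof -
  have finA: "finite (A \<rightarrow>\<^sub>E C)" and finB: "finite (B \<rightarrow>\<^sub>E C)"
    using A B C by (auto intro: finite_PiE finite_subset)
  have "(\<Sum>c\<in>A \<rightarrow>\<^sub>E C. (\<Prod>e\<in>A. w e (c e)) * f (restrict c B)) =
        (\<Sum>g\<in>B \<rightarrow>\<^sub>E C. \<Sum>c\<in>{c \<in> A \<rightarrow>\<^sub>E C. restrict c B = g}. (\<Prod>e\<in>A. w e (c e)) * f (restrict c B))"
    by (rule sum.group[symmetric, OF finA finB]) (use B in auto)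
  also have "\<dots> = (\<Sum>g\<in>B \<rightarrow>\<^sub>E C. (\<Prod>e\<in>B. w e (g e)) * f g)"
  proof (rule sum.cong[OF refl])
    fix g assume g: "g \<in> B \<rightarrow>\<^sub>E C"
    \<comment> \<open>The extensions of \<open>g\<close> form a product set, free outside
      \<open>B\<close>, so the sum over them factors again.\<close>
    have fibre: "{c \<in> A \<rightarrow>\<^sub>E C. restrict c B = g} = (\<Pi>\<^sub>E e\<in>A. if e \<in> B then {g e} else C)"
    proof (intro subset_antisym subsetI)
      fix c assume "c \<in> {c \<in> A \<rightarrow>\<^sub>E C. restrict c B = g}"
      then show "c \<in> (\<Pi>\<^sub>E e\<in>A. if e \<in> B then {g e} else C)" by auto
    next
      fix c assume c: "c \<in> (\<Pi>\<^sub>E e\<in>A. if e \<in> B then {g e} else C)"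
      have "c e = g e" if "e \<in> B" for e using PiE_mem[OF c, of e] that B by auto
      moreover have "c e \<in> C" if "e \<in> A" for e
        using PiE_mem[OF c that] g by (auto split: if_splits)
      ultimately show "c \<in> {c \<in> A \<rightarrow>\<^sub>E C. restrict c B = g}"
        using c g by (auto simp: restrict_def PiE_def extensional_def fun_eq_iff)
    qed
    have "(\<Sum>c\<in>{c \<in> A \<rightarrow>\<^sub>E C. restrict c B = g}. (\<Prod>e\<in>A. w e (c e)) * f (restrict c B)) =
          (\<Sum>c\<in>{c \<in> A \<rightarrow>\<^sub>E C. restrict c B = g}. \<Prod>e\<in>A. w e (c e)) * f g"
      by (simp add: sum_distrib_right)
    also have "(\<Sum>c\<in>{c \<in> A \<rightarrow>\<^sub>E C. restrict c B = g}. \<Prod>e\<in>A. w e (c e)) =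
               (\<Prod>e\<in>A. \<Sum>k\<in>(if e \<in> B then {g e} else C). w e k)"
      unfolding fibre by (rule prod_sum_PiE[symmetric]) (use A C in auto)
    also have "\<dots> = (\<Prod>e\<in>A. if e \<in> B then w e (g e) else 1)"
      by (intro prod.cong) (auto simp: w)
    also have "\<dots> = (\<Prod>e\<in>B. w e (g e))"
      using A B by (simp add: prod.If_cases Int_absorb1)
    finally show "(\<Sum>c\<in>{c \<in> A \<rightarrow>\<^sub>E C. restrict c B = g}. (\<Prod>e\<in>A. w e (c e)) * f (restrict c B)) =
          (\<Prod>e\<in>B. w e (g e)) * f g" .
  qed
  finally show ?thesis .
qed

text \<open>Makes the color probabilities of an edge add up to 1; \<open>r \<ge> 3\<close> ensures
  that all three biased colors are available.\<close>

lemma sum_color_bias: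
  assumes "r \<ge> 3"
  shows "(\<Sum>k\<in>{1..r}. color_bias k) = 0"
proof -
  have "(\<Sum>k\<in>{1..r}. color_bias k) = (\<Sum>k\<in>{1, 2, 3}. color_bias k)"
    by (rule sum.mono_neutral_right) (use assms in \<open>auto simp: color_bias_def\<close>)
  then show ?thesis by (simp add: color_bias_def)
qed

lemma abs_edge_sign:
  assumes "x \<in> sign_vectors V" "e \<subseteq> V"
  shows "\<bar>edge_sign x e\<bar> = 1"
proof -
  have "\<bar>x v\<bar> = 1" if "v \<in> e" for v
    using that assms PiE_mem[of x V "\<lambda>_. {-1, 1}" v] by force
  then show ?thesis by (simp add: edge_sign_def abs_prod)
qed

text \<open>A copy of a complete graph is represented by its vertex set. An arbitrary
  \<open>V\<close> is allowed so that vertices can be deleted and renamed later.\<close>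

definition rainbow_sets :: "nat \<Rightarrow> ('a set \<Rightarrow> nat) \<Rightarrow> 'a set \<Rightarrow> 'a set set" where
  "rainbow_sets t c V = {K \<in> [V]\<^bsup>t\<^esup>. inj_on c ([K]\<^bsup>2\<^esup>)}"

lemma finite_rainbow_sets: "finite V \<Longrightarrow> finite (rainbow_sets t c V)"
  by (simp add: rainbow_sets_def finite_imp_finite_nsets)

lemma card_nsets_choose: "finite A \<Longrightarrow> card ([A]\<^bsup>k\<^esup>) = card A choose k"
proof -
  assume A: "finite A"
  have "[A]\<^bsup>k\<^esup> = {B. B \<subseteq> A \<and> card B = k}" using A by (auto simp: nsets_def intro: finite_subset)
  then show ?thesis using n_subsets[OF A] by simp
qed

section \<open>Injective colorings of one clique\<close>

text \<open>The \<open>1/4\<close> is the product of the three nonzero biases: one injective coloring with a triangle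
  colored 1, 2, 3 suffices for the strict gain over the uniform random coloring.\<close>

definition biased_rainbow_bound :: "nat \<Rightarrow> nat \<Rightarrow> real" where
  "biased_rainbow_bound e r = (real (r choose e) * fact e + 1/4) / real r ^ e"

text \<open>Both sides are the falling factorial of \<open>r\<close> of length
  \<open>card B\<close>, the numerator in the definition of rainbow-common; both vanish when there
  are too few colors.\<close>

lemma card_inj_PiE:
  assumes "finite B"
  shows "real (card {f \<in> B \<rightarrow>\<^sub>E {1..r}. inj_on f B}) = real (r choose card B) * fact (card B)"
proof -
  have "card {f \<in> B \<rightarrow>\<^sub>E {1..r}. inj_on f B} = (\<Prod>i = 0..<card B. r - i)"
    using card_inj_on_subset_funcset[OF assms, of "{1..r}" B] by simp
  also have "real \<dots> = real (r choose card B) * fact (card B)"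
  proof (cases "card B \<le> r")
    case True
    then have "real (\<Prod>i = 0..<card B. r - i) = (\<Prod>i = 0..<card B. real r - real i)"
      by (auto simp: of_nat_diff intro!: prod.cong)
    also have "\<dots> = fact (card B) * (real r gchoose card B)"
      by (rule gbinomial_mult_fact[symmetric])
    finally show ?thesis by (simp add: binomial_gbinomial)
  next
    case False
    \<comment> \<open>The index \<open>i = r\<close> is in range and contributes the factor
      0.\<close>
    then have "(\<Prod>i = 0..<card B. r - i) = 0" by (intro prod_zero bexI[of _ r]) auto
    then show ?thesis using False by (simp add: binomial_eq_0)
  qed
  finally show ?thesis .
qed

lemma inj_coloring_with_triangle:
  assumes B: "finite B" "card B \<le> r" "e1 \<in> B" "e2 \<in> B" "e3 \<in> B" "e1 \<noteq> e2" "e1 \<noteq> e3" "e2 \<noteq> e3"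
  obtains g where "g \<in> B \<rightarrow>\<^sub>E {1..r}" "inj_on g B" "g e1 = 1" "g e2 = 2" "g e3 = (3::nat)"
proof -
  have sub: "{e1, e2, e3} \<subseteq> B" using B by auto
  have c3: "card {e1, e2, e3} = 3" using B by auto
  have "card (B - {e1, e2, e3}) = card B - 3"
    using B sub c3 by (simp only: card_Diff_subset finite.intros)
  \<comment> \<open>Colors 1, 2, 3 are reserved for the three chosen edges; the \<open>r - 3\<close>
    others suffice for the rest of \<open>B\<close>.\<close>
  also have "\<dots> \<le> card {4..r}" using B by simp
  finally obtain h where h: "h ` (B - {e1, e2, e3}) \<subseteq> {4..r}" "inj_on h (B - {e1, e2, e3})"
    using card_le_inj[of "B - {e1, e2, e3}" "{4..r}"] B by auto
  have r: "3 \<le> r" using card_mono[OF B(1) sub] c3 B by simp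
  define g where "g = restrict (h(e1 := 1, e2 := 2, e3 := 3)) B"
  have ge: "g e1 = 1" "g e2 = 2" "g e3 = 3" using B by (auto simp: g_def)
  have gh: "g e = h e" "4 \<le> h e" "h e \<le> r" if "e \<in> B - {e1, e2, e3}" for e
    using that h by (auto simp: g_def)
  have "g e \<in> {1..r}" if "e \<in> B" for e
    using gh[of e] ge r that by (cases "e \<in> {e1, e2, e3}") auto
  then have "g \<in> B \<rightarrow>\<^sub>E {1..r}" by (auto simp: g_def)
  moreover have "inj_on g B"
  proof -
    have inj_h: "inj_on g (B - {e1, e2, e3})" using h(2) gh(1) by (metis (no_types, lifting) inj_on_cong)
    show ?thesis
    proof (rule inj_onI)
      fix x y assume "x \<in> B" "y \<in> B" "g x = g y"
      then show "x = y"
        using inj_onD[OF inj_h, of x y] gh[of x] gh[of y] ge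
        by (cases "x \<in> {e1, e2, e3}"; cases "y \<in> {e1, e2, e3}") auto
    qed
  qed
  ultimately show ?thesis using that ge by blast
qed

text \<open>Every injective coloring contributes at least its unbiased share, and one that puts
  colors 1, 2, 3 on a triangle contributes a quarter more. The bounds on \<open>t\<close> and
  \<open>r\<close> supply such a triangle and such a coloring.\<close>

lemma sum_biased_inj_colorings_ge:
  assumes V: "finite V" and K: "K \<in> [V]\<^bsup>t\<^esup>" and t: "t \<ge> 3" and r: "r \<ge> t choose 2"
  shows "(\<Sum>g\<in>{g \<in> [K]\<^bsup>2\<^esup> \<rightarrow>\<^sub>E {1..r}. inj_on g ([K]\<^bsup>2\<^esup>)}. \<Sum>x\<in>sign_vectors V.
            \<Prod>e\<in>[K]\<^bsup>2\<^esup>. 1 + color_bias (g e) * edge_sign x e)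
         \<ge> (real (r choose (t choose 2)) * fact (t choose 2) + 1/4) * 2 ^ card V"
proof -
  define B where "B = [K]\<^bsup>2\<^esup>"
  define I where "I = {g \<in> B \<rightarrow>\<^sub>E {1..r}. inj_on g B}"
  define F where "F g = (\<Sum>x\<in>sign_vectors V. \<Prod>e\<in>B. 1 + color_bias (g e) * edge_sign x e)" for g
  have K': "finite K" "card K = t" "K \<subseteq> V" using K by (auto simp: nsets_def)
  have B: "finite B" "card B = t choose 2" "B \<subseteq> [V]\<^bsup>2\<^esup>"
    using K' by (auto simp: B_def finite_imp_finite_nsets card_nsets_choose nsets_mono[THEN subsetD])
  have finI: "finite I" using B by (auto simp: I_def intro!: finite_PiE)
  obtain T where "T \<subseteq> K" "card T = 3" using t K' by (metis obtain_subset_with_card_n)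
  then obtain a b d where abd: "a \<in> K" "b \<in> K" "d \<in> K" "a \<noteq> b" "b \<noteq> d" "a \<noteq> d"
    by (auto simp: card_3_iff)
  have mem: "{a, b} \<in> B" "{b, d} \<in> B" "{a, d} \<in> B" using abd by (auto simp: B_def)
  obtain g where g: "g \<in> B \<rightarrow>\<^sub>E {1..r}" "inj_on g B" "g {a, b} = 1" "g {b, d} = 2" "g {a, d} = (3::nat)"
    by (rule inj_coloring_with_triangle[of B r "{a, b}" "{b, d}" "{a, d}"])
       (use B r mem abd in \<open>auto simp: doubleton_eq_iff\<close>)
  then have gI: "g \<in> I" by (simp add: I_def)
  have "F g \<ge> 5/4 * 2 ^ card V"
    unfolding F_def by (rule sum_prod_bias_ge_triangle[OF V B(3) g(2)]) (use abd mem g in auto)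
  moreover have "sum F (I - {g}) \<ge> (\<Sum>_\<in>I - {g}. 2 ^ card V)"
    unfolding F_def by (intro sum_mono sum_prod_bias_ge V B) (auto simp: I_def)
  moreover have "card I = Suc (card (I - {g}))" using card.remove[OF finI gI] .
  \<comment> \<open>Counting in units of \<open>2 ^ card V\<close>:
    \<open>5/4 + (card I - 1) = card I + 1/4\<close>.\<close>
  ultimately have "F g + sum F (I - {g}) \<ge> (real (card I) + 1/4) * 2 ^ card V"
    by (simp add: algebra_simps)
  then have "sum F I \<ge> (real (card I) + 1/4) * 2 ^ card V"
    using sum.remove[OF finI gI, of F] by simp
  then show ?thesis
    using card_inj_PiE[OF B(1), of r] B by (simp add: I_def F_def B_def)
qed

text \<open>First moment argument: if no coloring has more than \<open>N\<close> rainbow sets,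
  neither does the average over the biased random coloring, and that average is bounded below one
  vertex set at a time. Colorings need not be surjective here.\<close>

lemma rainbow_sets_average_bound:
  assumes V: "finite V" and t: "t \<ge> 3" and r: "r \<ge> t choose 2"
    and N: "\<And>c. c \<in> [V]\<^bsup>2\<^esup> \<rightarrow>\<^sub>E {1..r} \<Longrightarrow> card (rainbow_sets t c V) \<le> N"
  shows "biased_rainbow_bound (t choose 2) r * real (card V choose t) \<le> real N"
proof -
  define E where "E = [V]\<^bsup>2\<^esup>"
  define q where "q = t choose 2"
  define w :: "('a \<Rightarrow> real) \<Rightarrow> 'a set \<Rightarrow> nat \<Rightarrow> real"
    where "w x e k = (1 + color_bias k * edge_sign x e) / real r" for x e k
  have "3 choose 2 \<le> t choose 2" using t by (rule binomial_right_mono)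
  then have r3: "r \<ge> 3" using r by (simp add: numeral_eq_Suc)
  have finE: "finite E" using V by (simp add: E_def finite_imp_finite_nsets)
  have sum_w: "(\<Sum>k\<in>{1..r}. w x e k) = 1" for x e
    using sum_color_bias[OF r3] r3
    by (simp add: w_def sum.distrib flip: sum_divide_distrib sum_distrib_right)
  \<comment> \<open>Biases and signs have absolute value at most 1, so the weights are genuine
    probabilities; \<open>upper\<close> relies on this for monotonicity.\<close>
  have w_nonneg: "w x e k \<ge> 0" if "x \<in> sign_vectors V" "e \<in> E" for x e k
  proof -
    have "\<bar>edge_sign x e\<bar> = 1" using that by (intro abs_edge_sign[of x V]) (auto simp: E_def nsets_def)
    then have "\<bar>color_bias k * edge_sign x e\<bar> \<le> 1" by (simp add: abs_mult color_bias_def)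
    then show ?thesis by (simp add: w_def abs_le_iff)
  qed
  have upper: "(\<Sum>c\<in>E \<rightarrow>\<^sub>E {1..r}. (\<Prod>e\<in>E. w x e (c e)) * real (card (rainbow_sets t c V))) \<le> real N"
    if x: "x \<in> sign_vectors V" for x
  proof -
    have "(\<Sum>c\<in>E \<rightarrow>\<^sub>E {1..r}. (\<Prod>e\<in>E. w x e (c e)) * real (card (rainbow_sets t c V)))
          \<le> (\<Sum>c\<in>E \<rightarrow>\<^sub>E {1..r}. (\<Prod>e\<in>E. w x e (c e)) * real N)"
      by (intro sum_mono mult_left_mono prod_nonneg ballI w_nonneg x of_nat_mono N) (auto simp: E_def)
    also have "\<dots> = (\<Prod>e\<in>E. \<Sum>k\<in>{1..r}. w x e k) * real N"
      by (subst prod_sum_PiE) (use finE in \<open>auto simp: sum_distrib_right\<close>)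
    finally show ?thesis by (simp only: sum_w prod.neutral_const mult_1)
  qed
  \<comment> \<open>Given the signs, edges are colored independently, so all edges outside
    \<open>K\<close> sum out. The sum over \<open>x\<close> is left unnormalized, whence the factor
    \<open>2 ^ card V\<close>.\<close>
  have one_set: "(\<Sum>x\<in>sign_vectors V. \<Sum>c\<in>E \<rightarrow>\<^sub>E {1..r}. (\<Prod>e\<in>E. w x e (c e)) * of_bool (inj_on c ([K]\<^bsup>2\<^esup>)))
        \<ge> biased_rainbow_bound q r * 2 ^ card V" if K: "K \<in> [V]\<^bsup>t\<^esup>" for K
  proof -
    define B where "B = [K]\<^bsup>2\<^esup>"
    have K': "finite K" "card K = t" "K \<subseteq> V" using K by (auto simp: nsets_def)
    have B: "finite B" "card B = q" "B \<subseteq> E"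
      using K' by (auto simp: B_def q_def E_def finite_imp_finite_nsets card_nsets_choose nsets_mono[THEN subsetD])
    have "(\<Sum>x\<in>sign_vectors V. \<Sum>c\<in>E \<rightarrow>\<^sub>E {1..r}. (\<Prod>e\<in>E. w x e (c e)) * of_bool (inj_on c B)) =
          (\<Sum>x\<in>sign_vectors V. \<Sum>c\<in>E \<rightarrow>\<^sub>E {1..r}. (\<Prod>e\<in>E. w x e (c e)) * of_bool (inj_on (restrict c B) B))"
      by (simp add: inj_on_restrict_eq)
    also have "\<dots> = (\<Sum>x\<in>sign_vectors V. \<Sum>g\<in>B \<rightarrow>\<^sub>E {1..r}. (\<Prod>e\<in>B. w x e (g e)) * of_bool (inj_on g B))"
      by (intro sum.cong refl sum_PiE_marginal finE B sum_w) auto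
    also have "\<dots> = (\<Sum>g\<in>B \<rightarrow>\<^sub>E {1..r}. \<Sum>x\<in>sign_vectors V. (\<Prod>e\<in>B. w x e (g e)) * of_bool (inj_on g B))"
      by (rule sum.swap)
    also have "\<dots> = (\<Sum>g\<in>{g \<in> B \<rightarrow>\<^sub>E {1..r}. inj_on g B}. \<Sum>x\<in>sign_vectors V. (\<Prod>e\<in>B. w x e (g e)))"
      by (rule sum.mono_neutral_cong_right) (use B in \<open>auto intro!: finite_PiE\<close>)
    also have "\<dots> = (\<Sum>g\<in>{g \<in> B \<rightarrow>\<^sub>E {1..r}. inj_on g B}. \<Sum>x\<in>sign_vectors V.
            \<Prod>e\<in>B. 1 + color_bias (g e) * edge_sign x e) / real r ^ q"
      by (simp add: w_def prod_dividef B sum_divide_distrib)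
    also have "\<dots> \<ge> ((real (r choose q) * fact q + 1/4) * 2 ^ card V) / real r ^ q"
      unfolding B_def q_def
      by (intro divide_right_mono sum_biased_inj_colorings_ge V K t r) auto
    finally show ?thesis by (simp add: biased_rainbow_bound_def B_def)
  qed
  have count: "real (card (rainbow_sets t c V)) = (\<Sum>K\<in>[V]\<^bsup>t\<^esup>. of_bool (inj_on c ([K]\<^bsup>2\<^esup>)))" for c
    using V by (simp add: rainbow_sets_def finite_imp_finite_nsets Int_def)
  have "(\<Sum>K\<in>[V]\<^bsup>t\<^esup>. biased_rainbow_bound q r * 2 ^ card V) \<le>
        (\<Sum>K\<in>[V]\<^bsup>t\<^esup>. \<Sum>x\<in>sign_vectors V. \<Sum>c\<in>E \<rightarrow>\<^sub>E {1..r}. (\<Prod>e\<in>E. w x e (c e)) * of_bool (inj_on c ([K]\<^bsup>2\<^esup>)))"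
    by (intro sum_mono one_set)
  also have "\<dots> = (\<Sum>x\<in>sign_vectors V. \<Sum>K\<in>[V]\<^bsup>t\<^esup>. \<Sum>c\<in>E \<rightarrow>\<^sub>E {1..r}. (\<Prod>e\<in>E. w x e (c e)) * of_bool (inj_on c ([K]\<^bsup>2\<^esup>)))"
    by (rule sum.swap)
  also have "\<dots> = (\<Sum>x\<in>sign_vectors V. \<Sum>c\<in>E \<rightarrow>\<^sub>E {1..r}. \<Sum>K\<in>[V]\<^bsup>t\<^esup>. (\<Prod>e\<in>E. w x e (c e)) * of_bool (inj_on c ([K]\<^bsup>2\<^esup>)))"
    by (intro sum.cong refl sum.swap)
  also have "\<dots> = (\<Sum>x\<in>sign_vectors V. \<Sum>c\<in>E \<rightarrow>\<^sub>E {1..r}. (\<Prod>e\<in>E. w x e (c e)) * real (card (rainbow_sets t c V)))"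
    unfolding count by (simp only: sum_distrib_left)
  also have "\<dots> \<le> (\<Sum>x\<in>sign_vectors V. real N)"
    by (intro sum_mono upper)
  finally have "real (card V choose t) * biased_rainbow_bound q r * 2 ^ card V \<le> 2 ^ card V * real N"
    using V by (simp add: card_nsets_choose card_sign_vectors)
  then show ?thesis by (simp add: q_def mult_ac)
qed

section \<open>The rainbow density of complete graphs\<close>

text \<open>An isomorphism onto a complete graph forces every pair of vertices to be an edge, so a
  copy is determined by its vertex set.\<close>

lemma copies_complete_graph:
  "copies (complete_graph t) (complete_graph n) = (\<lambda>K. (K, [K]\<^bsup>2\<^esup>)) ` [{..<n}]\<^bsup>t\<^esup>"
proof (intro subset_antisym subsetI)
  fix S assume "S \<in> copies (complete_graph t) (complete_graph n)"
  then obtain f where fin: "finite (verts_of S)" and E: "edges_of S \<subseteq> [verts_of S]\<^bsup>2\<^esup>"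
    and sub: "verts_of S \<subseteq> {..<n}"
    and f: "bij_betw f (verts_of S) {..<t}"
    and iso: "\<And>u v. u \<in> verts_of S \<Longrightarrow> v \<in> verts_of S \<Longrightarrow>
                {u, v} \<in> edges_of S \<longleftrightarrow> {f u, f v} \<in> [{..<t}]\<^bsup>2\<^esup>"
    by (auto simp: copies_def subgraph_of_def simple_graph_def graph_isomorphic_def complete_graph_def)
  have "card (verts_of S) = t" using bij_betw_same_card[OF f] by simp
  then have "verts_of S \<in> [{..<n}]\<^bsup>t\<^esup>" using fin sub by (simp add: nsets_def)
  moreover have "[verts_of S]\<^bsup>2\<^esup> \<subseteq> edges_of S"
  proof
    fix e assume "e \<in> [verts_of S]\<^bsup>2\<^esup>"
    then obtain u v where e: "e = {u, v}" "u \<in> verts_of S" "v \<in> verts_of S" "u \<noteq> v"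
      by (auto elim: nsets2_E)
    then have "f u \<noteq> f v" "f u \<in> {..<t}" "f v \<in> {..<t}"
      using f by (auto simp: bij_betw_def dest: inj_onD)
    then show "e \<in> edges_of S" using iso[of u v] e by simp
  qed
  ultimately show "S \<in> (\<lambda>K. (K, [K]\<^bsup>2\<^esup>)) ` [{..<n}]\<^bsup>t\<^esup>"
    using E by (intro image_eqI[of _ _ "verts_of S"]) (auto simp: prod_eq_iff)
next
  fix S assume "S \<in> (\<lambda>K. (K, [K]\<^bsup>2\<^esup>)) ` [{..<n}]\<^bsup>t\<^esup>"
  then obtain K where K: "K \<subseteq> {..<n}" "finite K" "card K = t" and S: "S = (K, [K]\<^bsup>2\<^esup>)"
    by (auto simp: nsets_def)
  obtain f where f: "bij_betw f K {..<t}"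
    using K by (metis card_lessThan finite_lessThan finite_same_card_bij)
  have "\<forall>u\<in>K. \<forall>v\<in>K. {u, v} \<in> [K]\<^bsup>2\<^esup> \<longleftrightarrow> {f u, f v} \<in> [{..<t}]\<^bsup>2\<^esup>"
  proof (intro ballI)
    fix u v assume uv: "u \<in> K" "v \<in> K"
    then have "f u \<in> {..<t}" "f v \<in> {..<t}" "f u = f v \<longleftrightarrow> u = v"
      using f by (auto simp: bij_betw_def dest: inj_onD)
    then show "{u, v} \<in> [K]\<^bsup>2\<^esup> \<longleftrightarrow> {f u, f v} \<in> [{..<t}]\<^bsup>2\<^esup>" using uv by simp
  qed
  then show "S \<in> copies (complete_graph t) (complete_graph n)"
    using K f nsets_mono[OF K(1), of 2]
    by (auto simp: S copies_def subgraph_of_def simple_graph_def graph_isomorphic_def complete_graph_def)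
qed

lemma inj_on_Pair_fun: "inj_on (\<lambda>K. (K, f K)) A"
  by (auto intro: inj_onI)

lemma card_copies_complete_graph:
  "card (copies (complete_graph t) (complete_graph n)) = n choose t"
  by (simp add: copies_complete_graph card_image inj_on_Pair_fun card_nsets_choose)

lemma card_rainbow_copies:
  "card {S \<in> copies (complete_graph t) (complete_graph n). rainbow c S} = card (rainbow_sets t c {..<n})"
proof -
  have "{S \<in> copies (complete_graph t) (complete_graph n). rainbow c S} =
        (\<lambda>K. (K, [K]\<^bsup>2\<^esup>)) ` rainbow_sets t c {..<n}"
    by (auto simp: copies_complete_graph rainbow_def rainbow_sets_def)
  then show ?thesis by (simp add: card_image inj_on_Pair_fun)
qed

section \<open>From arbitrary to surjective colorings\<close>

text \<open>Moving a repeated color to a missing one never destroys injectivity, so the surjectivity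
  required of colorings does not affect the maximum.\<close>

lemma surjective_recoloring:
  assumes "finite X" "c ` X \<subseteq> {1..r}" "r \<le> card X"
  obtains c' where "is_coloring r X c'" "\<And>Y. Y \<subseteq> X \<Longrightarrow> inj_on c Y \<Longrightarrow> inj_on c' Y"
proof -
  have "\<exists>c'. is_coloring r X c' \<and> (\<forall>Y\<subseteq>X. inj_on c Y \<longrightarrow> inj_on c' Y)"
    using assms(2)
  \<comment> \<open>Induction on the number of missing colors.\<close>
  proof (induction "card ({1..r} - c ` X)" arbitrary: c rule: less_induct)
    case less
    show ?case
    proof (cases "c ` X = {1..r}")
      case True
      then show ?thesis by (auto simp: is_coloring_def)
    next
      case False
      then obtain k where k: "k \<in> {1..r}" "k \<notin> c ` X" using less.prems by blast
      \<comment> \<open>A color is missing and \<open>r \<le> card X\<close>, so by pigeonhole two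
        elements share a color. Recoloring \<open>x\<close> then loses no color, because
        \<open>y\<close> keeps the old one.\<close>
      have "card (c ` X) < card {1..r}"
        using False less.prems by (intro psubset_card_mono) auto
      then have "\<not> inj_on c X" using assms(3) by (auto dest: card_image)
      then obtain x y where xy: "x \<in> X" "y \<in> X" "x \<noteq> y" "c x = c y" by (auto simp: inj_on_def)
      define c1 where "c1 = c(x := k)"
      have img: "c1 ` X = insert k (c ` X)"
      proof (intro subset_antisym subsetI)
        fix z assume "z \<in> insert k (c ` X)"
        then consider "z = k" | w where "w \<in> X" "z = c w" "w \<noteq> x" | "z = c y"
          using xy by auto
        then show "z \<in> c1 ` X"
        proof cases
          case 1
          then show ?thesis using xy(1) by (auto simp: c1_def)
        next
          case 2
          then show ?thesis by (auto simp: c1_def)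
        next
          case 3
          then have "z = c1 y" using xy by (simp add: c1_def)
          then show ?thesis using xy by blast
        qed
      qed (auto simp: c1_def)
      have "{1..r} - c1 ` X \<subset> {1..r} - c ` X" using k img by auto
      then have "card ({1..r} - c1 ` X) < card ({1..r} - c ` X)"
        by (intro psubset_card_mono) auto
      moreover have "c1 ` X \<subseteq> {1..r}" using img k less.prems by auto
      ultimately obtain c' where c': "is_coloring r X c'" "\<forall>Y\<subseteq>X. inj_on c1 Y \<longrightarrow> inj_on c' Y"
        using less.hyps by blast
      have "inj_on c1 Y" if "Y \<subseteq> X" "inj_on c Y" for Y
        unfolding c1_def using that k by (intro inj_on_fun_updI) auto
      then show ?thesis using c' by blast
    qed
  qed
  then show ?thesis using that by blast
qed

text \<open>Replaces the maximum over surjective colorings by one over all maps into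
  \<open>{1..r}\<close>. The bound on \<open>r\<close> makes surjective colorings exist, so that
  \<open>Max\<close> is taken over a nonempty set.\<close>

lemma
  assumes r: "r \<le> n choose 2" and r0: "0 < r"
  shows max_rainbow_copies_ge:
      "\<And>c. c ` [{..<n}]\<^bsup>2\<^esup> \<subseteq> {1..r} \<Longrightarrow>
         card (rainbow_sets t c {..<n}) \<le> max_rainbow_copies (complete_graph t) n r"
    and max_rainbow_copies_attained:
      "\<exists>c. c ` [{..<n}]\<^bsup>2\<^esup> \<subseteq> {1..r} \<and>
         max_rainbow_copies (complete_graph t) n r = card (rainbow_sets t c {..<n})"
proof -
  define M where "M = {card (rainbow_sets t c {..<n}) | c. is_coloring r ([{..<n}]\<^bsup>2\<^esup>) c}"
  have max: "max_rainbow_copies (complete_graph t) n r = Max M"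
    by (simp add: max_rainbow_copies_def card_rainbow_copies M_def complete_graph_def[of n])
       (simp add: complete_graph_def flip: card_rainbow_copies)
  have "card (rainbow_sets t c {..<n}) \<le> card ([{..<n}]\<^bsup>t\<^esup>)" for c
    by (rule card_mono) (auto simp: rainbow_sets_def finite_imp_finite_nsets)
  then have "M \<subseteq> {..n choose t}" by (auto simp: M_def card_nsets_choose)
  then have finM: "finite M" by (rule finite_subset) simp
  have fin: "finite ([{..<n}]\<^bsup>2\<^esup>)" by (simp add: finite_imp_finite_nsets)
  have card: "r \<le> card ([{..<n}]\<^bsup>2\<^esup>)" using r by (simp add: card_nsets_choose)
  have recolor: "\<exists>m\<in>M. card (rainbow_sets t c {..<n}) \<le> m" if c: "c ` [{..<n}]\<^bsup>2\<^esup> \<subseteq> {1..r}" for c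
  proof -
    obtain c' where c': "is_coloring r ([{..<n}]\<^bsup>2\<^esup>) c'"
      "\<And>Y. Y \<subseteq> [{..<n}]\<^bsup>2\<^esup> \<Longrightarrow> inj_on c Y \<Longrightarrow> inj_on c' Y"
      using surjective_recoloring[OF fin c card] by blast
    have "rainbow_sets t c {..<n} \<subseteq> rainbow_sets t c' {..<n}"
    proof
      fix K assume K: "K \<in> rainbow_sets t c {..<n}"
      then have "[K]\<^bsup>2\<^esup> \<subseteq> [{..<n}]\<^bsup>2\<^esup>"
        by (intro nsets_mono) (auto simp: rainbow_sets_def nsets_def)
      then show "K \<in> rainbow_sets t c' {..<n}" using K c'(2) by (simp add: rainbow_sets_def)
    qed
    then have "card (rainbow_sets t c {..<n}) \<le> card (rainbow_sets t c' {..<n})"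
      by (intro card_mono finite_rainbow_sets) auto
    then show ?thesis using c'(1) by (auto simp: M_def)
  qed
  show "card (rainbow_sets t c {..<n}) \<le> max_rainbow_copies (complete_graph t) n r"
    if "c ` [{..<n}]\<^bsup>2\<^esup> \<subseteq> {1..r}" for c
    using recolor[OF that] Max_ge[OF finM] unfolding max by (meson order.trans)
  have "M \<noteq> {}"
  proof -
    \<comment> \<open>Recoloring the constant coloring yields a surjective one.\<close>
    have "(\<lambda>_. 1) ` [{..<n}]\<^bsup>2\<^esup> \<subseteq> {1..r}" using r0 by auto
    then show ?thesis using recolor by blast
  qed
  then have "Max M \<in> M" using finM by (rule Max_in[rotated])
  then show "\<exists>c. c ` [{..<n}]\<^bsup>2\<^esup> \<subseteq> {1..r} \<and>
         max_rainbow_copies (complete_graph t) n r = card (rainbow_sets t c {..<n})"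
    unfolding max by (auto simp: M_def is_coloring_def)
qed

section \<open>Monotonicity of the rainbow ratio\<close>

lemma card_rainbow_sets_image:
  assumes g: "inj_on g V"
  shows "card (rainbow_sets t c (g ` V)) = card (rainbow_sets t (\<lambda>e. c (g ` e)) V)"
proof -
  have nsets_image: "[g ` K]\<^bsup>k\<^esup> = (`) g ` [K]\<^bsup>k\<^esup>" if "K \<subseteq> V" for K k
    using bij_betw_nsets[of g K "g ` K" k] g that by (auto simp: bij_betw_def inj_on_subset)
  have inj_iff: "inj_on c ([g ` K]\<^bsup>2\<^esup>) \<longleftrightarrow> inj_on (\<lambda>e. c (g ` e)) ([K]\<^bsup>2\<^esup>)" if "K \<subseteq> V" for K
  proof -
    have "inj_on ((`) g) ([K]\<^bsup>2\<^esup>)" using g that by (intro inj_on_nsets) (rule inj_on_subset)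
    then show ?thesis using comp_inj_on_iff[of "(`) g" "[K]\<^bsup>2\<^esup>" c] nsets_image[OF that]
      by (simp add: comp_def)
  qed
  have "rainbow_sets t c (g ` V) = (`) g ` rainbow_sets t (\<lambda>e. c (g ` e)) V"
    using inj_iff by (auto simp: rainbow_sets_def nsets_image[OF order.refl]) (auto simp: nsets_def)
  moreover have "inj_on ((`) g) (rainbow_sets t (\<lambda>e. c (g ` e)) V)"
    by (rule inj_on_subset[OF inj_on_nsets[OF g, of t]]) (auto simp: rainbow_sets_def)
  ultimately show ?thesis by (simp add: card_image)
qed

text \<open>Averages an optimal coloring over the deletion of one vertex.\<close>

lemma max_rainbow_copies_Suc:
  assumes r: "r \<le> n choose 2" and r0: "0 < r" and t: "t \<le> n"
  shows "max_rainbow_copies (complete_graph t) (Suc n) r * (Suc n - t) \<le>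
         Suc n * max_rainbow_copies (complete_graph t) n r"
proof -
  define M where "M = max_rainbow_copies (complete_graph t) n r"
  have "n choose 2 \<le> Suc n choose 2" by (rule binomial_right_mono) simp
  then obtain c where c: "c ` [{..<Suc n}]\<^bsup>2\<^esup> \<subseteq> {1..r}"
    and max: "max_rainbow_copies (complete_graph t) (Suc n) r = card (rainbow_sets t c {..<Suc n})"
    using max_rainbow_copies_attained[of r "Suc n" t] r r0 by auto
  define R where "R = rainbow_sets t c {..<Suc n}"
  have finR: "finite R" by (simp add: R_def finite_rainbow_sets)
  \<comment> \<open>The remaining \<open>n\<close> vertices are renamed to \<open>{..<n}\<close> by
    \<open>g\<close>. The coloring pulled back along \<open>g\<close> may miss colors, which
    \<open>max_rainbow_copies_ge\<close> permits.\<close>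
  have delete: "card {K\<in>R. v \<notin> K} \<le> M" if v: "v < Suc n" for v
  proof -
    have "card {..<n} = card ({..<Suc n} - {v})" using v by simp
    then obtain g where g: "bij_betw g {..<n} ({..<Suc n} - {v})"
      by (metis finite_Diff finite_lessThan finite_same_card_bij)
    then have inj: "inj_on g {..<n}" and img: "g ` {..<n} = {..<Suc n} - {v}"
      by (auto simp: bij_betw_def)
    have "{K\<in>R. v \<notin> K} = rainbow_sets t c (g ` {..<n})"
      unfolding img by (auto simp: R_def rainbow_sets_def nsets_def)
    then have "card {K\<in>R. v \<notin> K} = card (rainbow_sets t (\<lambda>e. c (g ` e)) {..<n})"
      using card_rainbow_sets_image[OF inj] by simp
    also have "\<dots> \<le> M"
      unfolding M_def
    proof (rule max_rainbow_copies_ge[OF r r0])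
      have "(`) g ` [{..<n}]\<^bsup>2\<^esup> \<subseteq> [{..<Suc n}]\<^bsup>2\<^esup>"
        using bij_betw_nsets[OF g, of 2] nsets_mono[of "{..<Suc n} - {v}" "{..<Suc n}" 2]
        by (auto simp: bij_betw_def)
      then show "(\<lambda>e. c (g ` e)) ` [{..<n}]\<^bsup>2\<^esup> \<subseteq> {1..r}" using c by blast
    qed
    finally show ?thesis .
  qed
  \<comment> \<open>Double counting of the pairs of a rainbow set and a vertex outside it.\<close>
  have "card R * (Suc n - t) = (\<Sum>K\<in>R. card {v\<in>{..<Suc n}. v \<notin> K})"
  proof -
    have "card {v\<in>{..<Suc n}. v \<notin> K} = Suc n - t" if "K \<in> R" for K
    proof -
      have "{v\<in>{..<Suc n}. v \<notin> K} = {..<Suc n} - K" by auto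
      then show ?thesis
        using that by (auto simp: R_def rainbow_sets_def nsets_def card_Diff_subset)
    qed
    then show ?thesis by simp
  qed
  also have "\<dots> = (\<Sum>v\<in>{..<Suc n}. card {K\<in>R. v \<notin> K})"
    using sum.swap_restrict[OF finR, of "{..<Suc n}" "\<lambda>_ _. 1::nat" "\<lambda>K v. v \<notin> K"] by simp
  also have "\<dots> \<le> (\<Sum>v\<in>{..<Suc n}. M)" by (intro sum_mono delete) simp
  finally show ?thesis by (simp add: max R_def M_def)
qed

text \<open>The deletion inequality divided by the identity \<open>absorb\<close> for the numbers of
  copies.\<close>

lemma max_rainbow_ratio_Suc_le:
  assumes r: "r \<le> n choose 2" and r0: "0 < r" and t: "t \<le> n"
  shows "max_rainbow_ratio (complete_graph t) (Suc n) r \<le> max_rainbow_ratio (complete_graph t) n r"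
proof -
  define M where "M k = max_rainbow_copies (complete_graph t) k r" for k
  have pos: "0 < n choose t" "0 < Suc n choose t" using t by (simp_all add: zero_less_binomial_iff)
  have absorb: "(Suc n choose t) * (Suc n - t) = Suc n * (n choose t)"
    using binomial_absorb_comp[of "Suc n" t] by (simp add: mult.commute)
  have "M (Suc n) * (n choose t) * Suc n = M (Suc n) * (Suc n * (n choose t))"
    by (simp only: mult_ac)
  also have "\<dots> = M (Suc n) * (Suc n - t) * (Suc n choose t)"
    unfolding absorb[symmetric] by (simp only: mult_ac)
  also have "\<dots> \<le> Suc n * M n * (Suc n choose t)"
    using max_rainbow_copies_Suc[OF r r0 t] unfolding M_def by (rule mult_right_mono) simp
  finally have "M (Suc n) * (n choose t) \<le> M n * (Suc n choose t)"
    by (metis mult.assoc mult.commute mult_le_cancel2 zero_less_Suc)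
  then have "real (M (Suc n)) * real (n choose t) \<le> real (M n) * real (Suc n choose t)"
    by (metis of_nat_le_iff of_nat_mult)
  then show ?thesis
    using pos by (simp add: max_rainbow_ratio_def card_copies_complete_graph M_def divide_simps)
qed

section \<open>Passage to the limit\<close>

lemma max_rainbow_ratio_ge:
  assumes r: "r \<le> n choose 2" and r0: "0 < r" and tn: "t \<le> n" and t: "t \<ge> 3" and rt: "r \<ge> t choose 2"
  shows "max_rainbow_ratio (complete_graph t) n r \<ge> biased_rainbow_bound (t choose 2) r"
proof -
  have "biased_rainbow_bound (t choose 2) r * real (card {..<n} choose t)
        \<le> real (max_rainbow_copies (complete_graph t) n r)"
    by (intro rainbow_sets_average_bound t rt max_rainbow_copies_ge r r0) auto
  moreover have "0 < n choose t" using tn by (simp add: zero_less_binomial_iff)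
  ultimately show ?thesis
    by (simp add: max_rainbow_ratio_def card_copies_complete_graph pos_le_divide_eq)
qed

lemma le_choose_two: "m \<le> Suc m choose 2"
  by (simp add: numeral_2_eq_2)

text \<open>\<open>lim\<close> is informative only for convergent sequences, so convergence is
  proved first: the ratios eventually decrease and stay above the biased bound.\<close>

lemma max_rainbow_density_ge:
  assumes t: "t \<ge> 3" and r: "r \<ge> t choose 2"
  shows "max_rainbow_density (complete_graph t) r \<ge> biased_rainbow_bound (t choose 2) r"
proof -
  \<comment> \<open>From \<open>n0\<close> on, \<open>r\<close>-colorings exist and
    \<open>t \<le> n\<close>; smaller \<open>n\<close>, where the maximum may be unspecified, are
    skipped by an index shift.\<close>
  define n0 where "n0 = t + Suc r"
  have "0 < t choose 2" using t by (simp add: zero_less_binomial_iff)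
  then have r0: "0 < r" using r by (rule less_le_trans)
  define X where "X n = max_rainbow_ratio (complete_graph t) n r" for n
  have large: "r \<le> n choose 2" "t \<le> n" if "n \<ge> n0" for n
    using le_choose_two[of r] binomial_right_mono[of "Suc r" n 2] that by (auto simp: n0_def)
  have "decseq (\<lambda>n. X (n + n0))"
    by (intro decseq_SucI) (use large r0 max_rainbow_ratio_Suc_le in \<open>auto simp: X_def\<close>)
  moreover have "\<forall>n. biased_rainbow_bound (t choose 2) r \<le> X (n + n0)"
    using large max_rainbow_ratio_ge[OF _ r0 _ t r] by (auto simp: X_def)
  ultimately obtain L where L: "(\<lambda>n. X (n + n0)) \<longlonglongrightarrow> L" using decseq_convergent by blast
  have "biased_rainbow_bound (t choose 2) r \<le> L"
    by (rule LIMSEQ_le_const[OF L]) (use \<open>\<forall>n. _ \<le> X (n + n0)\<close> in auto)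
  moreover have "X \<longlonglongrightarrow> L" using L by (rule LIMSEQ_offset)
  then have "max_rainbow_density (complete_graph t) r = L"
    by (simp add: max_rainbow_density_def X_def[abs_def] limI)
  ultimately show ?thesis by simp
qed

text \<open>The density exceeds the uniform value by at least \<open>1/4\<close> divided by
  \<open>r ^ (t choose 2)\<close>, which is positive since \<open>r > 0\<close>.\<close>

lemma complete_graph_rainbow_uncommon:
  assumes t: "t \<ge> 3" and r: "r \<ge> t choose 2"
  shows "rainbow_uncommon r (complete_graph t)"
proof -
  have edges: "card (edges_of (complete_graph t)) = t choose 2"
    by (simp add: complete_graph_def card_nsets_choose)
  have "0 < t choose 2" using t by (simp add: zero_less_binomial_iff)
  then have "0 < r" using r by (rule less_le_trans)
  then have "real (r choose (t choose 2)) * fact (t choose 2) / real r ^ (t choose 2)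
        < biased_rainbow_bound (t choose 2) r"
    by (simp add: biased_rainbow_bound_def divide_strict_right_mono)
  also have "\<dots> \<le> max_rainbow_density (complete_graph t) r"
    by (rule max_rainbow_density_ge[OF t r])
  finally show ?thesis
    by (simp add: rainbow_uncommon_def rainbow_common_def edges)
qed

theorem theorem3:
  fixes t :: nat
  assumes "t \<ge> 6"
  shows "\<exists>r\<^sub>t::nat. \<forall>r\<ge>r\<^sub>t. rainbow_uncommon r (complete_graph t)"
  \<comment> \<open>The threshold is the number of edges of the clique, the least number of colors
    that admits a rainbow copy.\<close>
  using complete_graph_rainbow_uncommon[of t] assms by (intro exI[of _ "t choose 2"]) auto

end
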